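(* Let $(X, p)$ be a compact pseudometric space, and let $T : G \curvearrowright X$ be a continuous action of a locally compact unimodular topological group $G$ (not necessarily amenable) on $X$. Let $\mu$ be a regular Borel probability measure on $X$. Fix a point $x_0 \in X$, and for each $g \in G$, $r \in [0, \infty)$, let $$D_{x_0}(g, r) = \sup\left\{ p(T_g x_0, T_g x) : x \in X, \ p(x_0, x) \leq r \right\},$$ and assume that $D_{x_0}(\cdot, r) : G \to [0, \infty)$ is measurable for each $r \in (0, \infty)$. Let $(F_i)_{i \in \mathscr{I}}$ be a net of compact subsets of $G$ with positive Haar measure. Let $(C_i)_{i \in \mathscr{I}}$ be a net of measurable subsets of $X$ such that $\mu(C_i)>0$ and $x_0 \in C_i$ for all $i \in \mathscr{I}$. Suppose that for every $\delta > 0$, $$\lim_i \frac{m\left( \left\{ g \in F_i : D_{x_0}(g, \operatorname{diam}(C_i)) > \delta \right\} \right)}{m(F_i)} = 0 .$$ Let $f : X \to \mathbb{C}$ be a continuous function. Then $$\lim_i \left| \left( \operatorname{Avg}_{F_i} f \right)(x_0) - \alpha_{C_i}\left( \operatorname{Avg}_{F_i} f \right) \right| = 0 .$$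
   Context: $m$ denotes a (bi-invariant) Haar measure on $G$. For a compact $K \subseteq G$ with $m(K)>0$ and $f \in C(X)$, $\operatorname{Avg}_K f(x) = \frac{1}{m(K)} \int_K f(T_g x) \, \mathrm{d}m(g)$, a continuous function on $X$. For a measurable $C \subseteq X$ with $\mu(C)>0$, $\alpha_C(h) = \frac{1}{\mu(C)} \int_C h \, \mathrm{d}\mu$. $\operatorname{diam}(C) = \sup_{x,y \in C} p(x,y)$. The measure $\mu$ is not assumed to be $T$-invariant. *)

theory Defs
  imports
    "HOL-Probability.Probability_Measure"
    "HOL-Algebra.Group_Action"
begin

definition directed_on :: "'i set \<Rightarrow> ('i \<Rightarrow> 'i \<Rightarrow> bool) \<Rightarrow> bool" where
  "directed_on I prec \<longleftrightarrow>
     I \<noteq> {} \<and>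
     (\<forall>i\<in>I. prec i i) \<and>
     (\<forall>i\<in>I. \<forall>j\<in>I. \<forall>k\<in>I. prec i j \<longrightarrow> prec j k \<longrightarrow> prec i k) \<and>
     (\<forall>i\<in>I. \<forall>j\<in>I. \<exists>k\<in>I. prec i k \<and> prec j k)"

definition net_filter :: "'i set \<Rightarrow> ('i \<Rightarrow> 'i \<Rightarrow> bool) \<Rightarrow> 'i filter" where
  "net_filter I prec = (INF j\<in>I. principal {i\<in>I. prec j i})"

lemma eventually_net_filter:
  assumes "directed_on I prec"
  shows "eventually P (net_filter I prec) \<longleftrightarrow> (\<exists>j\<in>I. \<forall>i\<in>I. prec j i \<longrightarrow> P i)"
proof -
  have "eventually P (net_filter I prec) \<longleftrightarrow>
      (\<exists>j\<in>I. eventually P (principal {i\<in>I. prec j i}))"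
    unfolding net_filter_def
  proof (rule eventually_INF_base)
    show "I \<noteq> {}"
      using assms unfolding directed_on_def by (rule conjunct1)
    fix a b assume ab: "a \<in> I" "b \<in> I"
    have trans: "prec i l" if "i \<in> I" "j \<in> I" "l \<in> I" "prec i j" "prec j l" for i j l
      using assms that unfolding directed_on_def by metis
    have "\<forall>i\<in>I. \<forall>j\<in>I. \<exists>k\<in>I. prec i k \<and> prec j k"
      using assms unfolding directed_on_def by (elim conjE)
    then have "\<exists>k\<in>I. prec a k \<and> prec b k"
      using ab by (metis (no_types, lifting))
    then obtain k where k: "k \<in> I" "prec a k" "prec b k"
      by (elim bexE conjE)
    have "{i\<in>I. prec k i} \<subseteq> {i\<in>I. prec a i} \<inter> {i\<in>I. prec b i}"
      using trans[OF ab(1) k(1) _ k(2)] trans[OF ab(2) k(1) _ k(3)] by blast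
    then show "\<exists>x\<in>I. principal {i\<in>I. prec x i} \<le>
        inf (principal {i\<in>I. prec a i}) (principal {i\<in>I. prec b i})"
      using k(1) by (intro bexI[of _ k]) simp_all
  qed
  then show ?thesis
    unfolding eventually_principal by blast
qed

locale Pseudometric_space =
  fixes X :: "'x set" and p :: "'x \<Rightarrow> 'x \<Rightarrow> real"
  assumes nonneg: "\<lbrakk>x \<in> X; y \<in> X\<rbrakk> \<Longrightarrow> 0 \<le> p x y"
    and refl: "x \<in> X \<Longrightarrow> p x x = 0"
    and commute: "\<lbrakk>x \<in> X; y \<in> X\<rbrakk> \<Longrightarrow> p x y = p y x"
    and triangle: "\<lbrakk>x \<in> X; y \<in> X; z \<in> X\<rbrakk> \<Longrightarrow> p x z \<le> p x y + p y z"

definition pseudometric_topology :: "'x set \<Rightarrow> ('x \<Rightarrow> 'x \<Rightarrow> real) \<Rightarrow> 'x topology" where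
  "pseudometric_topology X p =
     topology (\<lambda>U. U \<subseteq> X \<and> (\<forall>x\<in>U. \<exists>r>0. {y\<in>X. p x y < r} \<subseteq> U))"

lemma openin_pseudometric_topology:
  "openin (pseudometric_topology X p) U \<longleftrightarrow>
     U \<subseteq> X \<and> (\<forall>x\<in>U. \<exists>r>0. {y\<in>X. p x y < r} \<subseteq> U)"
proof -
  have "istopology (\<lambda>U. U \<subseteq> X \<and> (\<forall>x\<in>U. \<exists>r>0. {y\<in>X. p x y < r} \<subseteq> U))"
    unfolding istopology_def
  proof (intro conjI allI impI)
    fix S T
    assume S: "S \<subseteq> X \<and> (\<forall>x\<in>S. \<exists>r>0. {y\<in>X. p x y < r} \<subseteq> S)"
      and T: "T \<subseteq> X \<and> (\<forall>x\<in>T. \<exists>r>0. {y\<in>X. p x y < r} \<subseteq> T)"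
    show "S \<inter> T \<subseteq> X" using S by blast
    show "\<forall>x\<in>S \<inter> T. \<exists>r>0. {y\<in>X. p x y < r} \<subseteq> S \<inter> T"
    proof
      fix x assume x: "x \<in> S \<inter> T"
      obtain r s where "r > 0" "{y\<in>X. p x y < r} \<subseteq> S" "s > 0" "{y\<in>X. p x y < s} \<subseteq> T"
        using S T x by blast
      then show "\<exists>r>0. {y\<in>X. p x y < r} \<subseteq> S \<inter> T"
        by (intro exI[of _ "min r s"]) auto
    qed
  next
    fix K
    assume K: "\<forall>S\<in>K. S \<subseteq> X \<and> (\<forall>x\<in>S. \<exists>r>0. {y\<in>X. p x y < r} \<subseteq> S)"
    show "\<Union>K \<subseteq> X" using K by blast
    show "\<forall>x\<in>\<Union>K. \<exists>r>0. {y\<in>X. p x y < r} \<subseteq> \<Union>K"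
    proof
      fix x assume "x \<in> \<Union>K"
      then obtain S where S: "S \<in> K" "x \<in> S" by (rule UnionE)
      with K obtain r where "r > 0" "{y\<in>X. p x y < r} \<subseteq> S" by blast
      with S show "\<exists>r>0. {y\<in>X. p x y < r} \<subseteq> \<Union>K" by (intro exI[of _ r]) auto
    qed
  qed
  then show ?thesis
    by (simp add: pseudometric_topology_def topology_inverse')
qed

lemma topspace_pseudometric_topology [simp]: "topspace (pseudometric_topology X p) = X"
proof (rule subset_antisym)
  show "topspace (pseudometric_topology X p) \<subseteq> X"
    using openin_topspace[of "pseudometric_topology X p"]
    unfolding openin_pseudometric_topology by (rule conjunct1)
  have "\<forall>x\<in>X. \<exists>r>0. {y\<in>X. p x y < r} \<subseteq> X"
    by (intro ballI exI[of _ "1::real"] conjI zero_less_one Collect_subset)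
  then have "openin (pseudometric_topology X p) X"
    unfolding openin_pseudometric_topology by (intro conjI subset_refl)
  then show "X \<subseteq> topspace (pseudometric_topology X p)"
    by (rule openin_subset)
qed

definition pdiam :: "('x \<Rightarrow> 'x \<Rightarrow> real) \<Rightarrow> 'x set \<Rightarrow> real" where
  "pdiam p C = (SUP (x, y)\<in>C \<times> C. p x y)"

definition borel_of :: "'a topology \<Rightarrow> 'a measure" where
  "borel_of \<tau> = sigma (topspace \<tau>) {U. openin \<tau> U}"

definition outer_regular_at :: "'a topology \<Rightarrow> 'a measure \<Rightarrow> 'a set \<Rightarrow> bool" where
  "outer_regular_at \<tau> M A \<longleftrightarrow>
     emeasure M A = (INF U\<in>{U. openin \<tau> U \<and> A \<subseteq> U}. emeasure M U)"

text \<open>Compact sets need not be Borel in a space that is not Hausdorff, for instance in a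
  pseudometric space.\<close>

definition inner_regular_at :: "'a topology \<Rightarrow> 'a measure \<Rightarrow> 'a set \<Rightarrow> bool" where
  "inner_regular_at \<tau> M A \<longleftrightarrow>
     emeasure M A = (SUP K\<in>{K. compactin \<tau> K \<and> K \<in> sets M \<and> K \<subseteq> A}. emeasure M K)"

definition regular_borel_measure :: "'a topology \<Rightarrow> 'a measure \<Rightarrow> bool" where
  "regular_borel_measure \<tau> M \<longleftrightarrow>
     sets M = sets (borel_of \<tau>) \<and>
     (\<forall>A\<in>sets M. outer_regular_at \<tau> M A \<and> inner_regular_at \<tau> M A)"

locale topological_group = group G for G (structure) +
  fixes \<tau> :: "'a topology"
  assumes topspace_eq: "topspace \<tau> = carrier G"
    and continuous_mult: "continuous_map (prod_topology \<tau> \<tau>) \<tau> (\<lambda>(g, h). g \<otimes> h)"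
    and continuous_inv: "continuous_map \<tau> \<tau> (\<lambda>g. inv g)"

definition left_haar_measure :: "('g, 'b) monoid_scheme \<Rightarrow> 'g topology \<Rightarrow> 'g measure \<Rightarrow> bool" where
  "left_haar_measure G \<tau> m \<longleftrightarrow>
     sets m = sets (borel_of \<tau>) \<and>
     emeasure m (carrier G) \<noteq> 0 \<and>
     (\<forall>K. compactin \<tau> K \<longrightarrow> emeasure m K < \<infinity>) \<and>
     (\<forall>A\<in>sets m. outer_regular_at \<tau> m A) \<and>
     (\<forall>U. openin \<tau> U \<longrightarrow> inner_regular_at \<tau> m U) \<and>
     (\<forall>g\<in>carrier G. \<forall>A\<in>sets m. emeasure m (g <#\<^bsub>G\<^esub> A) = emeasure m A)"

definition unimodular :: "('g, 'b) monoid_scheme \<Rightarrow> 'g topology \<Rightarrow> bool" where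
  "unimodular G \<tau> \<longleftrightarrow>
     (\<forall>m. left_haar_measure G \<tau> m \<longrightarrow>
       (\<forall>g\<in>carrier G. \<forall>A\<in>sets m. emeasure m (A #>\<^bsub>G\<^esub> g) = emeasure m A))"

locale continuous_action = group_action G "topspace \<xi>" T
  for G :: "('g, 'b) monoid_scheme" and \<tau> :: "'g topology"
    and \<xi> :: "'x topology" and T :: "'g \<Rightarrow> 'x \<Rightarrow> 'x" +
  assumes jointly_continuous: "continuous_map (prod_topology \<tau> \<xi>) \<xi> (\<lambda>(g, x). T g x)"

definition Avg ::
    "'g measure \<Rightarrow> ('g \<Rightarrow> 'x \<Rightarrow> 'x) \<Rightarrow> 'g set \<Rightarrow> ('x \<Rightarrow> complex) \<Rightarrow> 'x \<Rightarrow> complex" where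
  "Avg m T K f x = (1 / measure m K) *\<^sub>R (LINT g:K|m. f (T g x))"

definition set_avg :: "'x measure \<Rightarrow> 'x set \<Rightarrow> ('x \<Rightarrow> complex) \<Rightarrow> complex" where
  "set_avg \<mu> C h = (1 / measure \<mu> C) *\<^sub>R (LINT x:C|\<mu>. h x)"

text \<open>The real suprema in \<^term>\<open>pdiam\<close> and below are genuine when the pseudometric is bounded
  (e.g. the space is compact) and \<^term>\<open>C \<noteq> {}\<close>, respectively \<^term>\<open>x0 \<in> X\<close> and \<^term>\<open>r \<ge> (0::real)\<close>.\<close>

definition orbit_dev ::
    "'x set \<Rightarrow> ('x \<Rightarrow> 'x \<Rightarrow> real) \<Rightarrow> ('g \<Rightarrow> 'x \<Rightarrow> 'x) \<Rightarrow> 'x \<Rightarrow> 'g \<Rightarrow> real \<Rightarrow> real" where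
  "orbit_dev X p T x0 g r = (SUP x\<in>{x\<in>X. p x0 x \<le> r}. p (T g x0) (T g x))"

end

theory Submission
  imports Defs
begin

text \<open>A continuous f on the compact space is uniformly continuous and bounded, so for x in
  \<open>C i\<close> and g in \<open>F i\<close> the values of f at \<open>T g x0\<close> and \<open>T g x\<close> are close unless g lies in
  the exceptional set where the orbit deviation exceeds the modulus of continuity. That set occupies
  a vanishing proportion of \<open>F i\<close>, so \<open>Avg m T (F i) f\<close> is nearly constant on \<open>C i\<close>, uniformly
  in x, and can be averaged over \<open>C i\<close> without Fubini. Measurability of this average in x comes from
  its continuity, a tube-lemma argument using the compactness of \<open>F i\<close>.\<close>

section \<open>Nets, measurability of continuous maps, and integral estimates\<close>

text \<open>The hypotheses on the net concern only indices in \<open>I\<close>; this makes them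
  available along the filter. Any element of the nonempty \<open>I\<close> serves as starting
  index.\<close>

lemma eventually_net_filter_in:
  assumes "directed_on I prec"
  shows "eventually (\<lambda>i. i \<in> I) (net_filter I prec)"
proof -
  have "I \<noteq> {}" using assms unfolding directed_on_def by blast
  then show ?thesis
    unfolding eventually_net_filter[OF assms] by blast
qed

lemma borel_measurable_continuous_map:
  fixes h :: "'a \<Rightarrow> 'b::topological_space"
  assumes "sets M = sets (borel_of \<tau>)" and "continuous_map \<tau> euclidean h"
  shows "h \<in> borel_measurable M"
proof (rule borel_measurableI)
  have sp: "space M = topspace \<tau>"
    using sets_eq_imp_space_eq[OF assms(1)]
    by (simp add: borel_of_def space_measure_of_conv)
  fix S :: "'b set" assume "open S"
  then have "openin \<tau> {x \<in> topspace \<tau>. h x \<in> S}"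
    using assms(2) by (auto intro: openin_continuous_map_preimage)
  moreover have "{U. openin \<tau> U} \<subseteq> Pow (topspace \<tau>)"
    by (auto dest: openin_subset)
  ultimately have "{x \<in> topspace \<tau>. h x \<in> S} \<in> sets (borel_of \<tau>)"
    unfolding borel_of_def by auto
  moreover have "h -` S \<inter> space M = {x \<in> topspace \<tau>. h x \<in> S}" using sp by auto
  ultimately show "h -` S \<inter> space M \<in> sets M" using assms(1) by simp
qed

lemma continuous_map_compact_bounded:
  fixes h :: "'a \<Rightarrow> 'b::real_normed_vector"
  assumes "compact_space \<xi>" "continuous_map \<xi> euclidean h"
  obtains B where "B > 0" "\<And>x. x \<in> topspace \<xi> \<Longrightarrow> norm (h x) \<le> B"
proof -
  have "compactin euclidean (h ` topspace \<xi>)"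
    using assms image_compactin unfolding compact_space_def by blast
  then have "bounded (h ` topspace \<xi>)" by (auto intro: compact_imp_bounded)
  then show thesis using that unfolding bounded_pos by auto
qed

lemma set_integrable_bounded:
  fixes u :: "'a \<Rightarrow> 'b::{banach,second_countable_topology}"
  assumes "u \<in> borel_measurable M" "A \<in> sets M" "emeasure M A < \<infinity>"
    and "\<And>x. x \<in> A \<Longrightarrow> norm (u x) \<le> b"
  shows "set_integrable M A u"
  unfolding set_integrable_def
  using assms by (intro integrableI_bounded_set_indicator[where B = b]) auto

text \<open>Separates a small bound \<open>a\<close> on the good part from a crude bound
  \<open>b\<close> on the exceptional set \<open>B\<close>, by integrating a single dominating step
  function.\<close>

lemma norm_set_integral_le:
  fixes u :: "'a \<Rightarrow> 'b::{banach,second_countable_topology}"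
  assumes u: "u \<in> borel_measurable M" and A: "A \<in> sets M" "emeasure M A < \<infinity>"
    and B: "B \<in> sets M" "B \<subseteq> A" and "0 \<le> a" "0 \<le> b"
    and bad: "\<And>x. x \<in> B \<Longrightarrow> norm (u x) \<le> b"
    and good: "\<And>x. x \<in> A - B \<Longrightarrow> norm (u x) \<le> a"
  shows "norm (LINT x:A|M. u x) \<le> a * measure M A + b * measure M B"
proof -
  have finB: "emeasure M B < \<infinity>"
    using emeasure_mono[OF B(2) A(1)] A(2) by (rule le_less_trans)
  \<comment> \<open>This crude bound serves only to make \<open>u\<close> integrable on
    \<open>A\<close>.\<close>
  have "norm (u x) \<le> max a b" if "x \<in> A" for x
    using bad[of x] good[of x] that by (cases "x \<in> B") auto
  then have int: "integrable M (\<lambda>x. indicator A x *\<^sub>R u x)"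
    using set_integrable_bounded[OF u A] unfolding set_integrable_def by blast
  have "norm (LINT x:A|M. u x) \<le> (\<integral>x. norm (indicator A x *\<^sub>R u x) \<partial>M)"
    unfolding set_lebesgue_integral_def by (rule integral_norm_bound)
  also have "\<dots> \<le> (\<integral>x. a * indicator A x + b * indicator B x \<partial>M)"
  proof (rule integral_mono[OF integrable_norm[OF int]])
    show "integrable M (\<lambda>x. a * indicator A x + b * indicator B x)"
      using A B finB by (intro Bochner_Integration.integrable_add integrable_mult_right) auto
    \<comment> \<open>On \<open>B\<close> the majorant is \<open>a + b\<close> instead of
      \<open>b\<close>, which is harmless because \<open>a\<close> is nonnegative.\<close>
    show "norm (indicator A x *\<^sub>R u x) \<le> a * indicator A x + b * indicator B x" for x
      using bad[of x] good[of x] B(2) \<open>0 \<le> a\<close> by (auto simp: indicator_def)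
  qed
  also have "\<dots> = a * measure M A + b * measure M B"
    using A B finB by (subst Bochner_Integration.integral_add) auto
  finally show ?thesis .
qed

section \<open>Continuity and compactness in pseudometric spaces\<close>

lemma (in Pseudometric_space) openin_pball:
  assumes "x \<in> X"
  shows "openin (pseudometric_topology X p) {y \<in> X. p x y < r}"
  unfolding openin_pseudometric_topology
proof (intro conjI ballI)
  fix y assume y: "y \<in> {y \<in> X. p x y < r}"
  have "{z \<in> X. p y z < r - p x y} \<subseteq> {z \<in> X. p x z < r}"
    using triangle[OF assms, of y] y by fastforce
  then show "\<exists>s>0. {z \<in> X. p y z < s} \<subseteq> {y \<in> X. p x y < r}"
    using y by (intro exI[of _ "r - p x y"]) auto
qed auto

lemma (in Pseudometric_space) continuous_map_pseudometric_euclidean: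
  fixes f :: "'x \<Rightarrow> 'b::metric_space"
  shows "continuous_map (pseudometric_topology X p) euclidean f \<longleftrightarrow>
    (\<forall>x\<in>X. \<forall>e>0. \<exists>d>0. \<forall>y\<in>X. p x y < d \<longrightarrow> dist (f x) (f y) < e)"
proof
  assume f: "continuous_map (pseudometric_topology X p) euclidean f"
  show "\<forall>x\<in>X. \<forall>e>0. \<exists>d>0. \<forall>y\<in>X. p x y < d \<longrightarrow> dist (f x) (f y) < e"
  proof (intro ballI allI impI)
    fix x and e :: real assume "x \<in> X" "e > 0"
    moreover have "openin (pseudometric_topology X p) {y \<in> X. f y \<in> ball (f x) e}"
      using openin_continuous_map_preimage[OF f, of "ball (f x) e"] by simp
    ultimately show "\<exists>d>0. \<forall>y\<in>X. p x y < d \<longrightarrow> dist (f x) (f y) < e"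
      unfolding openin_pseudometric_topology by fastforce
  qed
next
  assume *: "\<forall>x\<in>X. \<forall>e>0. \<exists>d>0. \<forall>y\<in>X. p x y < d \<longrightarrow> dist (f x) (f y) < e"
  show "continuous_map (pseudometric_topology X p) euclidean f"
    unfolding continuous_map_def
  proof (intro conjI allI impI)
    fix U :: "'b set" assume "openin euclidean U"
    then have U: "open U" by simp
    show "openin (pseudometric_topology X p)
        {x \<in> topspace (pseudometric_topology X p). f x \<in> U}"
      unfolding openin_pseudometric_topology
    proof (intro conjI ballI)
      fix x assume "x \<in> {x \<in> topspace (pseudometric_topology X p). f x \<in> U}"
      then have x: "x \<in> X" "f x \<in> U" by auto
      obtain e where e: "e > 0" "ball (f x) e \<subseteq> U"
        using U x(2) open_contains_ball by blast
      obtain d where "d > 0" "\<forall>y\<in>X. p x y < d \<longrightarrow> dist (f x) (f y) < e"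
        using * x(1) e(1) by blast
      then show "\<exists>r>0. {y \<in> X. p x y < r} \<subseteq>
          {x \<in> topspace (pseudometric_topology X p). f x \<in> U}"
        using e(2) by (intro exI[of _ d]) (auto simp: subset_iff)
    qed auto
  qed auto
qed

text \<open>By the triangle inequality the distance to a fixed point is 1-Lipschitz, hence
  continuous and bounded; two such distances control every \<open>p x y\<close>. The bound makes the
  real suprema in \<open>pdiam\<close> and \<open>orbit_dev\<close> genuine.\<close>

lemma (in Pseudometric_space) compact_bounded:
  assumes "compact_space (pseudometric_topology X p)"
  shows "\<exists>B. \<forall>x\<in>X. \<forall>y\<in>X. p x y \<le> B"
proof (cases "X = {}")
  case True
  then show ?thesis by simp
next
  case False
  then obtain a where a: "a \<in> X" by blast
  have "dist (p a x) (p a y) \<le> p x y" if "x \<in> X" "y \<in> X" for x y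
    using triangle[OF a that] triangle[OF a that(2,1)] commute[OF that]
    by (auto simp: dist_real_def)
  then have "continuous_map (pseudometric_topology X p) euclidean (p a)"
    unfolding continuous_map_pseudometric_euclidean by (meson le_less_trans)
  then obtain B where B: "B > 0" "\<And>x. x \<in> X \<Longrightarrow> norm (p a x) \<le> B"
    using continuous_map_compact_bounded[OF assms] by (metis topspace_pseudometric_topology)
  have "p x y \<le> 2 * B" if "x \<in> X" "y \<in> X" for x y
    using triangle[OF that(1) a that(2)] commute[OF that(1) a] B(2)[OF that(1)] B(2)[OF that(2)]
    by auto
  then show ?thesis by blast
qed

text \<open>Lebesgue number argument: finitely many balls of half the local radius cover the space,
  and the least half-radius is a uniform modulus.\<close>

lemma (in Pseudometric_space) compact_uniformly_continuous:
  fixes f :: "'x \<Rightarrow> 'b::metric_space"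
  assumes comp: "compact_space (pseudometric_topology X p)"
    and f: "continuous_map (pseudometric_topology X p) euclidean f" and "e > 0"
  obtains d where "d > 0" "\<And>x y. \<lbrakk>x \<in> X; y \<in> X; p x y < d\<rbrakk> \<Longrightarrow> dist (f x) (f y) < e"
proof -
  have "\<forall>x\<in>X. \<exists>d>0. \<forall>y\<in>X. p x y < d \<longrightarrow> dist (f x) (f y) < e / 2"
    using f \<open>e > 0\<close> half_gt_zero unfolding continuous_map_pseudometric_euclidean by blast
  then obtain d where d: "\<And>x. x \<in> X \<Longrightarrow> d x > 0"
      "\<And>x y. \<lbrakk>x \<in> X; y \<in> X; p x y < d x\<rbrakk> \<Longrightarrow> dist (f x) (f y) < e / 2"
    by metis
  \<comment> \<open>Halving the radii ensures that a point within the uniform modulus of a point of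
    \<open>V z\<close> still lies in the full ball of radius \<open>d z\<close> around
    \<open>z\<close>.\<close>
  define V where "V x = {y \<in> X. p x y < d x / 2}" for x
  have "x \<in> V x" if "x \<in> X" for x
    using that d(1)[OF that] refl[OF that] by (simp add: V_def)
  then have cover: "topspace (pseudometric_topology X p) \<subseteq> \<Union> (V ` X)" by auto
  have "\<And>U. U \<in> V ` X \<Longrightarrow> openin (pseudometric_topology X p) U"
    unfolding V_def using openin_pball by blast
  then obtain N where N: "finite N" "N \<subseteq> X" "X \<subseteq> \<Union> (V ` N)"
    using comp cover unfolding compact_space_alt
    by (metis (no_types, lifting) finite_subset_image topspace_pseudometric_topology)
  \<comment> \<open>Inserting 1 keeps \<open>Min\<close> on a nonempty set when \<open>N\<close> is
    empty.\<close>
  define \<delta> where "\<delta> = Min (insert 1 ((\<lambda>x. d x / 2) ` N))"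
  have "\<delta> > 0" using N d(1) unfolding \<delta>_def by (subst Min_gr_iff) auto
  moreover have "dist (f x) (f y) < e" if xy: "x \<in> X" "y \<in> X" "p x y < \<delta>" for x y
  proof -
    obtain z where z: "z \<in> N" "x \<in> V z" using N(3) xy(1) by blast
    have zX: "z \<in> X" using z(1) N(2) by blast
    have zx: "p z x < d z / 2" using z(2) by (simp add: V_def)
    have "\<delta> \<le> d z / 2" unfolding \<delta>_def using N(1) z(1) by (intro Min_le) auto
    then have "p z y < d z" using triangle[OF zX xy(1,2)] zx xy(3) by linarith
    moreover have "p z x < d z" using zx d(1)[OF zX] by linarith
    ultimately have "dist (f z) (f y) < e / 2" "dist (f z) (f x) < e / 2"
      using d(2) zX xy by auto
    then show ?thesis by (rule dist_triangle_half_r[rotated])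
  qed
  ultimately show thesis using that by blast
qed

section \<open>Joint continuity: the tube lemma and sections\<close>

text \<open>Tube lemma: joint continuity gives a box around each \<open>(g, x)\<close>; finitely
  many boxes cover the slice over \<open>K\<close>, and the intersection of their second factors
  works for all \<open>g\<close> in \<open>K\<close> at once.\<close>

lemma compactin_uniform_nbhd:
  fixes h :: "'a \<times> 'b \<Rightarrow> 'c::metric_space"
  assumes h: "continuous_map (prod_topology \<tau> \<xi>) euclidean h"
    and K: "compactin \<tau> K" and x: "x \<in> topspace \<xi>" and "e > 0"
  obtains V where "openin \<xi> V" "x \<in> V"
    "\<And>g y. \<lbrakk>g \<in> K; y \<in> V\<rbrakk> \<Longrightarrow> dist (h (g, x)) (h (g, y)) < e"
proof -
  have KG: "K \<subseteq> topspace \<tau>" using K by (rule compactin_subset_topspace)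
  define good where "good U V \<longleftrightarrow> openin \<xi> V \<and> x \<in> V \<and>
      (\<forall>g\<in>U. \<forall>y\<in>V. dist (h (g, x)) (h (g, y)) < e)" for U V
  have "\<exists>U V. openin \<tau> U \<and> g \<in> U \<and> good U V" if g: "g \<in> K" for g
  proof -
    \<comment> \<open>Inside a box both \<open>h (a, x)\<close> and \<open>h (a, y)\<close> are
      within \<open>e / 2\<close> of the common value \<open>h (g, x)\<close>, hence within
      \<open>e\<close> of each other.\<close>
    let ?W = "{z \<in> topspace (prod_topology \<tau> \<xi>). h z \<in> ball (h (g, x)) (e / 2)}"
    have "openin (prod_topology \<tau> \<xi>) ?W"
      using h by (rule openin_continuous_map_preimage) simp
    moreover have "(g, x) \<in> ?W" using g KG x \<open>e > 0\<close> by auto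
    ultimately obtain U V where UV: "openin \<tau> U" "openin \<xi> V" "g \<in> U" "x \<in> V" "U \<times> V \<subseteq> ?W"
      unfolding openin_prod_topology_alt by meson
    have "dist (h (a, x)) (h (a, y)) < e" if "a \<in> U" "y \<in> V" for a y
    proof (rule dist_triangle_half_r)
      show "dist (h (g, x)) (h (a, x)) < e / 2" "dist (h (g, x)) (h (a, y)) < e / 2"
        using UV(4,5) that by auto
    qed
    with UV show ?thesis unfolding good_def by blast
  qed
  then have "K \<subseteq> \<Union> {U. openin \<tau> U \<and> (\<exists>V. good U V)}" by blast
  moreover have "Ball {U. openin \<tau> U \<and> (\<exists>V. good U V)} (openin \<tau>)" by blast
  ultimately obtain \<F> where F: "finite \<F>" "\<F> \<subseteq> {U. openin \<tau> U \<and> (\<exists>V. good U V)}" "K \<subseteq> \<Union>\<F>"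
    using compactinD[OF K] by (metis (no_types, lifting) mem_Collect_eq)
  have "\<forall>U\<in>\<F>. \<exists>V. good U V" using F(2) by blast
  then obtain V where V: "\<forall>U\<in>\<F>. good U (V U)" by (rule bchoice[THEN exE])
  \<comment> \<open>If the subcover is empty, so is \<open>K\<close>; the empty intersection would
    be the whole type, which may not be open in \<xi>, so \<open>topspace\<close> replaces
    it.\<close>
  define W where "W = (if \<F> = {} then topspace \<xi> else \<Inter> (V ` \<F>))"
  have "openin \<xi> W"
    using F(1) V unfolding W_def good_def by (auto intro!: openin_Inter)
  moreover have "x \<in> W" using V x unfolding W_def good_def by auto
  moreover have "dist (h (g, x)) (h (g, y)) < e" if "g \<in> K" "y \<in> W" for g y
  proof -
    obtain U where U: "U \<in> \<F>" "g \<in> U" using F(3) \<open>g \<in> K\<close> by blast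
    then have "y \<in> V U" using \<open>y \<in> W\<close> unfolding W_def by (auto split: if_splits)
    then show ?thesis using V U unfolding good_def by blast
  qed
  ultimately show thesis using that by blast
qed

text \<open>Points at distance 0 lie in the same open sets, so \<open>y\<close> belongs to the
  preimage of every ball around \<open>S x\<close>. This handles the orbit deviation at radius
  0.\<close>

lemma (in Pseudometric_space) continuous_self_map_indistinguishable:
  assumes S: "continuous_map (pseudometric_topology X p) (pseudometric_topology X p) S"
    and x: "x \<in> X" and y: "y \<in> X" and "p x y = 0"
  shows "p (S x) (S y) = 0"
proof -
  have SX: "S x \<in> X" "S y \<in> X"
    using S x y by (auto simp: continuous_map_def)
  have "p (S x) (S y) < 0 + e" if "e > 0" for e
  proof -
    have "openin (pseudometric_topology X p) {z \<in> X. S z \<in> {w \<in> X. p (S x) w < e}}"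
      using openin_continuous_map_preimage[OF S openin_pball[OF SX(1)]] by simp
    moreover have "x \<in> {z \<in> X. S z \<in> {w \<in> X. p (S x) w < e}}"
      using x SX refl[OF SX(1)] that by simp
    ultimately obtain r where "r > 0" "{z \<in> X. p x z < r} \<subseteq> {z \<in> X. S z \<in> {w \<in> X. p (S x) w < e}}"
      unfolding openin_pseudometric_topology by blast
    then show ?thesis using y \<open>p x y = 0\<close> by auto
  qed
  then have "p (S x) (S y) \<le> 0" by (meson field_le_epsilon less_imp_le)
  then show ?thesis using nonneg[OF SX] by simp
qed

lemma continuous_map_section_left:
  assumes "continuous_map (prod_topology \<tau> \<xi>) \<zeta> (\<lambda>(g, x). T g x)" "x \<in> topspace \<xi>"
  shows "continuous_map \<tau> \<zeta> (\<lambda>g. T g x)"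
  using continuous_map_compose[of \<tau> "prod_topology \<tau> \<xi>" "\<lambda>g. (g, x)", OF _ assms(1)] assms(2)
  by (simp add: o_def continuous_map_pairedI)

lemma continuous_map_section_right:
  assumes "continuous_map (prod_topology \<tau> \<xi>) \<zeta> (\<lambda>(g, x). T g x)" "g \<in> topspace \<tau>"
  shows "continuous_map \<xi> \<zeta> (T g)"
  using continuous_map_compose[of \<xi> "prod_topology \<tau> \<xi>" "\<lambda>x. (g, x)", OF _ assms(1)] assms(2)
  by (simp add: o_def continuous_map_pairedI)

section \<open>Estimates for averages over the group and over the space\<close>

text \<open>The integrands differ by at most \<open>e\<close> off the exceptional set
  \<open>B\<close> and by at most \<open>2 * M\<close> on it. It is used both for continuity of the
  average, with \<open>B\<close> empty, and for the main estimate.\<close>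

lemma Avg_diff_le:
  assumes K: "K \<in> sets m" "emeasure m K < \<infinity>" "measure m K > 0"
    and meas: "(\<lambda>g. f (T g x)) \<in> borel_measurable m" "(\<lambda>g. f (T g y)) \<in> borel_measurable m"
    and bound: "\<And>g. g \<in> K \<Longrightarrow> cmod (f (T g x)) \<le> M" "\<And>g. g \<in> K \<Longrightarrow> cmod (f (T g y)) \<le> M"
    and B: "B \<in> sets m" "B \<subseteq> K" and "0 \<le> e"
    and good: "\<And>g. g \<in> K - B \<Longrightarrow> cmod (f (T g x) - f (T g y)) \<le> e"
  shows "cmod (Avg m T K f x - Avg m T K f y) \<le> e + 2 * M * (measure m B / measure m K)"
proof -
  \<comment> \<open>Positive measure gives a point of \<open>K\<close>, and a bound on a norm there
    is nonnegative.\<close>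
  have "K \<noteq> {}" using K(3) by auto
  then have "0 \<le> M" using bound(1) norm_ge_zero order_trans by blast
  have "set_integrable m K (\<lambda>g. f (T g x))" "set_integrable m K (\<lambda>g. f (T g y))"
    using meas bound by (auto intro!: set_integrable_bounded K(1,2))
  then have "Avg m T K f x - Avg m T K f y
      = (1 / measure m K) *\<^sub>R (LINT g:K|m. f (T g x) - f (T g y))"
    unfolding Avg_def by (simp add: scaleR_right_diff_distrib)
  then have "cmod (Avg m T K f x - Avg m T K f y)
      = cmod (LINT g:K|m. f (T g x) - f (T g y)) / measure m K"
    by simp
  also have "\<dots> \<le> (e * measure m K + 2 * M * measure m B) / measure m K"
  proof (rule divide_right_mono)
    show "cmod (LINT g:K|m. f (T g x) - f (T g y)) \<le> e * measure m K + 2 * M * measure m B"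
    proof (rule norm_set_integral_le[OF _ K(1,2) B \<open>0 \<le> e\<close> _ _ good])
      show "(\<lambda>g. f (T g x) - f (T g y)) \<in> borel_measurable m" using meas by simp
      show "0 \<le> 2 * M" using \<open>0 \<le> M\<close> by simp
      show "cmod (f (T g x) - f (T g y)) \<le> 2 * M" if "g \<in> B" for g
        using norm_triangle_ineq4[of "f (T g x)" "f (T g y)"] bound that B(2) by fastforce
    qed
  qed simp
  also have "\<dots> = e + 2 * M * (measure m B / measure m K)"
    using K(3) by (simp add: field_simps)
  finally show ?thesis .
qed

text \<open>A constant is its own average over \<open>C\<close>, so a bound uniform in
  \<open>x\<close> passes to the average. This replaces any interchange of integrals.\<close>

lemma set_avg_diff_le:
  assumes C: "C \<in> sets \<mu>" "emeasure \<mu> C < \<infinity>" "measure \<mu> C > 0"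
    and h: "h \<in> borel_measurable \<mu>"
    and near: "\<And>x. x \<in> C \<Longrightarrow> cmod (c - h x) \<le> e"
  shows "cmod (c - set_avg \<mu> C h) \<le> e"
proof -
  have "C \<noteq> {}" using C(3) by auto
  then have "0 \<le> e" using near norm_ge_zero order_trans by blast
  have "cmod (h x) \<le> cmod c + e" if "x \<in> C" for x
    using near[OF that] norm_triangle_sub[of "h x" c] by (simp add: norm_minus_commute)
  then have "set_integrable \<mu> C h" by (intro set_integrable_bounded[OF h C(1,2)])
  moreover have "set_integrable \<mu> C (\<lambda>_. c)" by (intro set_integrable_bounded[OF _ C(1,2)]) auto
  moreover have "(LINT x:C|\<mu>. c) = measure \<mu> C *\<^sub>R c"
    using C(1,2) by (simp add: set_lebesgue_integral_def)
  ultimately have "c - set_avg \<mu> C h = (1 / measure \<mu> C) *\<^sub>R (LINT x:C|\<mu>. c - h x)"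
    using C(3) unfolding set_avg_def by (simp add: scaleR_right_diff_distrib)
  then have "cmod (c - set_avg \<mu> C h) = cmod (LINT x:C|\<mu>. c - h x) / measure \<mu> C"
    by simp
  also have "\<dots> \<le> (e * measure \<mu> C) / measure \<mu> C"
    using norm_set_integral_le[of "\<lambda>x. c - h x" \<mu> C "{}" e 0] C h near \<open>0 \<le> e\<close>
    by (intro divide_right_mono) auto
  also have "\<dots> = e" using C(3) by simp
  finally show ?thesis .
qed

text \<open>The tube lemma applied to \<open>f (T g x)\<close> makes the integrands uniformly close
  over the compact \<open>K\<close>. Continuity is what makes the average Borel measurable in
  \<open>x\<close>.\<close>

lemma (in Pseudometric_space) continuous_map_Avg:
  assumes T: "continuous_map (prod_topology \<tau> (pseudometric_topology X p))
      (pseudometric_topology X p) (\<lambda>(g, x). T g x)"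
    and f: "continuous_map (pseudometric_topology X p) euclidean f"
    and m: "sets m = sets (borel_of \<tau>)"
    and K: "compactin \<tau> K" "K \<in> sets m" "emeasure m K < \<infinity>" "measure m K > 0"
    and bound: "\<And>x. x \<in> X \<Longrightarrow> cmod (f x) \<le> M"
  shows "continuous_map (pseudometric_topology X p) euclidean (Avg m T K f)"
  unfolding continuous_map_pseudometric_euclidean
proof (intro ballI allI impI)
  fix x and e :: real assume x: "x \<in> X" and "e > 0"
  have TX: "T g y \<in> X" if "g \<in> K" "y \<in> X" for g y
    using T that compactin_subset_topspace[OF K(1)] by (auto simp: continuous_map_def Pi_iff)
  have meas: "(\<lambda>g. f (T g y)) \<in> borel_measurable m" if "y \<in> X" for y
    using continuous_map_compose[OF continuous_map_section_left[OF T] f] that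
    by (auto intro: borel_measurable_continuous_map[OF m] simp: o_def)
  have fT: "continuous_map (prod_topology \<tau> (pseudometric_topology X p)) euclidean
      (f \<circ> (\<lambda>(g, x). T g x))"
    using T f by (rule continuous_map_compose)
  obtain V where V: "openin (pseudometric_topology X p) V" "x \<in> V"
      "\<And>g y. \<lbrakk>g \<in> K; y \<in> V\<rbrakk> \<Longrightarrow> dist (f (T g x)) (f (T g y)) < e / 2"
    using compactin_uniform_nbhd[OF fT K(1), of x "e / 2"] x \<open>e > 0\<close> by auto
  obtain d where d: "d > 0" "{y \<in> X. p x y < d} \<subseteq> V"
    using V(1,2) unfolding openin_pseudometric_topology by blast
  have "dist (Avg m T K f x) (Avg m T K f y) < e" if y: "y \<in> X" "p x y < d" for y
  proof -
    \<comment> \<open>With an empty exceptional set the term in \<open>M\<close> vanishes; the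
      remaining \<open>e / 2\<close> turns a weak inequality into a strict one.\<close>
    have "cmod (Avg m T K f x - Avg m T K f y) \<le> e / 2 + 2 * M * (measure m {} / measure m K)"
    proof (rule Avg_diff_le[OF K(2-4) meas[OF x] meas[OF y(1)]])
      show "cmod (f (T g x) - f (T g y)) \<le> e / 2" if "g \<in> K - {}" for g
        using V(3)[of g y] that d y by (auto simp: dist_norm)
    qed (use x y \<open>e > 0\<close> bound TX in auto)
    then show ?thesis using \<open>e > 0\<close> by (simp add: dist_norm)
  qed
  then show "\<exists>d>0. \<forall>y\<in>X. p x y < d \<longrightarrow> dist (Avg m T K f x) (Avg m T K f y) < e"
    using d(1) by blast
qed

section \<open>Convergence of the difference of averages along the net\<close>

theorem theorem3p2:
  fixes X :: "'x set" and p :: "'x \<Rightarrow> 'x \<Rightarrow> real"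
    and G :: "('g, 'b) monoid_scheme" and \<tau> :: "'g topology" and m :: "'g measure"
    and T :: "'g \<Rightarrow> 'x \<Rightarrow> 'x" and \<mu> :: "'x measure" and x0 :: 'x
    and I :: "'i set" and prec :: "'i \<Rightarrow> 'i \<Rightarrow> bool"
    and F :: "'i \<Rightarrow> 'g set" and C :: "'i \<Rightarrow> 'x set" and f :: "'x \<Rightarrow> complex"
  assumes "Pseudometric_space X p"
    and "compact_space (pseudometric_topology X p)"
    and "topological_group G \<tau>"
    and "locally_compact_space \<tau>"
    and "unimodular G \<tau>"
    and "left_haar_measure G \<tau> m"
    and "continuous_action G \<tau> (pseudometric_topology X p) T"
    and "prob_space \<mu>"
    and "regular_borel_measure (pseudometric_topology X p) \<mu>"
    and "x0 \<in> X"
    and "\<And>r. r > 0 \<Longrightarrow> (\<lambda>g. orbit_dev X p T x0 g r) \<in> borel_measurable m"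
    and "directed_on I prec"
    and "\<And>i. i \<in> I \<Longrightarrow> compactin \<tau> (F i)"
    and "\<And>i. i \<in> I \<Longrightarrow> measure m (F i) > 0"
    and "\<And>i. i \<in> I \<Longrightarrow> C i \<in> sets \<mu>"
    and "\<And>i. i \<in> I \<Longrightarrow> measure \<mu> (C i) > 0"
    and "\<And>i. i \<in> I \<Longrightarrow> x0 \<in> C i"
    and "\<And>\<delta>. \<delta> > 0 \<Longrightarrow>
      ((\<lambda>i. measure m {g \<in> F i. orbit_dev X p T x0 g (pdiam p (C i)) > \<delta>} / measure m (F i))
        \<longlongrightarrow> 0) (net_filter I prec)"
    and "continuous_map (pseudometric_topology X p) euclidean f"
  shows "((\<lambda>i. cmod (Avg m T (F i) f x0 - set_avg \<mu> (C i) (Avg m T (F i) f)))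
        \<longlongrightarrow> 0) (net_filter I prec)"
proof (rule tendstoI)
  fix e :: real assume "e > 0"
  interpret Pseudometric_space X p by fact
  interpret \<mu>: prob_space \<mu> by fact
  let ?\<xi> = "pseudometric_topology X p"
  note comp = assms(2) and dir = assms(12) and F = assms(13) and Fpos = assms(14)
    and f = assms(19)
  have T: "continuous_map (prod_topology \<tau> ?\<xi>) ?\<xi> (\<lambda>(g, x). T g x)"
    using assms(7) by (rule continuous_action.jointly_continuous)
  have m: "sets m = sets (borel_of \<tau>)" and Kfin: "\<And>K. compactin \<tau> K \<Longrightarrow> emeasure m K < \<infinity>"
    using assms(6) unfolding left_haar_measure_def by auto
  have m\<mu>: "sets \<mu> = sets (borel_of ?\<xi>)"
    using assms(9) unfolding regular_borel_measure_def by blast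
  have TX: "T g y \<in> X" if "g \<in> topspace \<tau>" "y \<in> X" for g y
    using T that by (auto simp: continuous_map_def Pi_iff)
  have meas: "(\<lambda>g. f (T g y)) \<in> borel_measurable m" if "y \<in> X" for y
    using continuous_map_compose[OF continuous_map_section_left[OF T] f] that
    by (auto intro: borel_measurable_continuous_map[OF m] simp: o_def)
  have sp\<mu>: "space \<mu> = X"
    using sets_eq_imp_space_eq[OF m\<mu>] by (simp add: borel_of_def space_measure_of_conv)
  obtain M where M: "M > 0" "\<And>x. x \<in> X \<Longrightarrow> cmod (f x) \<le> M"
    using continuous_map_compact_bounded[OF comp f] by (metis topspace_pseudometric_topology)
  obtain P where P: "\<And>x y. \<lbrakk>x \<in> X; y \<in> X\<rbrakk> \<Longrightarrow> p x y \<le> P"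
    using compact_bounded[OF comp] by blast
  \<comment> \<open>Error budget: \<open>e / 4\<close> from uniform continuity and
    \<open>e / 4\<close> from the exceptional set, so the total \<open>e / 2\<close> stays strictly
    below \<open>e\<close>.\<close>
  obtain d where d: "d > 0" "\<And>x y. \<lbrakk>x \<in> X; y \<in> X; p x y < d\<rbrakk> \<Longrightarrow> dist (f x) (f y) < e / 4"
    using compact_uniformly_continuous[OF comp f, of "e / 4"] \<open>e > 0\<close> by auto
  define B where "B i = {g \<in> F i. orbit_dev X p T x0 g (pdiam p (C i)) > d / 2}" for i
  \<comment> \<open>The threshold \<open>e / (8 * M)\<close> becomes \<open>e / 4\<close> after
    multiplication by the bound \<open>2 * M\<close> on the integrand.\<close>
  have "eventually (\<lambda>i. dist (measure m (B i) / measure m (F i)) 0 < e / (8 * M))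
      (net_filter I prec)"
    unfolding B_def using assms(18)[of "d / 2"] d(1) \<open>e > 0\<close> M(1) by (intro tendstoD) auto
  with eventually_net_filter_in[OF dir]
  show "eventually (\<lambda>i. dist (cmod (Avg m T (F i) f x0 - set_avg \<mu> (C i) (Avg m T (F i) f))) 0 < e)
      (net_filter I prec)"
  proof eventually_elim
    case (elim i)
    note i = elim(1)
    \<comment> \<open>A compact set need not be Borel here, but \<open>measure\<close> is 0 outside
      \<open>sets m\<close>, so positive measure forces measurability.\<close>
    have Fm: "F i \<in> sets m" using Fpos[OF i] measure_notin_sets by fastforce
    have Fsub: "F i \<subseteq> topspace \<tau>" using F[OF i] by (rule compactin_subset_topspace)
    have CX: "C i \<subseteq> X" using assms(15)[OF i] sets.sets_into_space sp\<mu> by blast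
    have diam: "p x y \<le> pdiam p (C i)" if "x \<in> C i" "y \<in> C i" for x y
    proof -
      have "bdd_above ((\<lambda>(x, y). p x y) ` (C i \<times> C i))"
        using P CX by (auto intro!: bdd_aboveI2[of _ _ P])
      then show ?thesis
        unfolding pdiam_def using cSUP_upper[of "(x, y)" "C i \<times> C i" "\<lambda>(x, y). p x y"] that by auto
    qed
    \<comment> \<open>Since \<open>x0\<close> lies in \<open>C i\<close>, every \<open>x\<close> in
      \<open>C i\<close> is within the diameter of \<open>x0\<close> and so competes in the
      supremum, which \<open>P\<close> bounds.\<close>
    have dev: "p (T g x0) (T g x) \<le> orbit_dev X p T x0 g (pdiam p (C i))"
      if "x \<in> C i" "g \<in> topspace \<tau>" for x g
      unfolding orbit_dev_def
      using P TX that \<open>x0 \<in> X\<close> CX diam[OF assms(17)[OF i]]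
      by (intro cSUP_upper2[where x = x] bdd_aboveI2[of _ _ P]) auto
    have Bm: "B i \<in> sets m"
    proof (cases "pdiam p (C i) > 0")
      case True
      note [measurable] = assms(11)[OF True] Fm
      have "B i = {g \<in> space m. g \<in> F i \<and> orbit_dev X p T x0 g (pdiam p (C i)) > d / 2}"
        using sets.sets_into_space[OF Fm] by (auto simp: B_def)
      also have "\<dots> \<in> sets m" by measurable
      finally show ?thesis .
    next
      \<comment> \<open>Measurability of the orbit deviation is not assumed at radius 0, where it vanishes.\<close>
      case False
      then have "pdiam p (C i) = 0"
        using diam[OF assms(17)[OF i] assms(17)[OF i]] refl[OF \<open>x0 \<in> X\<close>] by simp
      moreover have "orbit_dev X p T x0 g 0 = 0" if "g \<in> topspace \<tau>" for g
      proof -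
        have "p (T g x0) (T g x) = 0" if x: "x \<in> X" "p x0 x \<le> 0" for x
          using continuous_self_map_indistinguishable[OF continuous_map_section_right[OF T]]
            \<open>g \<in> topspace \<tau>\<close> x nonneg[OF \<open>x0 \<in> X\<close> x(1)] \<open>x0 \<in> X\<close> by auto
        then have "orbit_dev X p T x0 g 0 = (SUP x\<in>{x\<in>X. p x0 x \<le> 0}. 0)"
          unfolding orbit_dev_def by (intro SUP_cong) auto
        also have "\<dots> = 0" using \<open>x0 \<in> X\<close> refl[OF \<open>x0 \<in> X\<close>] by (intro cSUP_const) force
        finally show ?thesis .
      qed
      \<comment> \<open>The deviation is 0 and so cannot exceed the positive threshold
        \<open>d / 2\<close>.\<close>
      ultimately have "B i = {}" using Fsub d(1) by (auto simp: B_def)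
      then show ?thesis by simp
    qed
    have cont: "continuous_map ?\<xi> euclidean (Avg m T (F i) f)"
      using T f m F[OF i] Fm Kfin[OF F[OF i]] Fpos[OF i] M(2) by (rule continuous_map_Avg)
    \<comment> \<open>The average at \<open>x0\<close> plays the constant, compared with the average
      at each \<open>x\<close> in \<open>C i\<close> by a bound independent of
      \<open>x\<close>.\<close>
    have "cmod (Avg m T (F i) f x0 - set_avg \<mu> (C i) (Avg m T (F i) f)) \<le> e / 2"
    proof (rule set_avg_diff_le)
      show "Avg m T (F i) f \<in> borel_measurable \<mu>"
        using m\<mu> cont by (rule borel_measurable_continuous_map)
      fix x assume x: "x \<in> C i"
      have bound: "cmod (f (T g y)) \<le> M" if "g \<in> F i" "y \<in> X" for g y
        using M(2) TX Fsub that by blast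
      have "cmod (Avg m T (F i) f x0 - Avg m T (F i) f x)
          \<le> e / 4 + 2 * M * (measure m (B i) / measure m (F i))"
      proof (rule Avg_diff_le[OF Fm Kfin[OF F[OF i]] Fpos[OF i]])
        fix g assume g: "g \<in> F i - B i"
        then have gt: "g \<in> topspace \<tau>" using Fsub by blast
        \<comment> \<open>Outside \<open>B i\<close> the deviation is at most \<open>d / 2\<close>;
          the halving yields the strict inequality that uniform continuity asks for.\<close>
        have "p (T g x0) (T g x) < d"
          using dev[OF x gt] g d(1) by (auto simp: B_def)
        moreover have "T g x0 \<in> X" "T g x \<in> X" using TX[OF gt] \<open>x0 \<in> X\<close> x CX by auto
        ultimately have "dist (f (T g x0)) (f (T g x)) < e / 4" by (intro d(2))
        then show "cmod (f (T g x0) - f (T g x)) \<le> e / 4" by (simp add: dist_norm)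
      qed (use Bm meas bound CX x \<open>x0 \<in> X\<close> \<open>e > 0\<close> in \<open>auto simp: B_def\<close>)
      also have "2 * M * (measure m (B i) / measure m (F i)) \<le> 2 * M * (e / (8 * M))"
        using elim(2) M(1) by (intro mult_left_mono) auto
      also have "e / 4 + 2 * M * (e / (8 * M)) = e / 2"
        using M(1) by (simp add: field_simps)
      finally show "cmod (Avg m T (F i) f x0 - Avg m T (F i) f x) \<le> e / 2" by simp
    qed (use assms(15,16) i in \<open>auto simp: \<mu>.emeasure_finite less_top[symmetric]\<close>)
    then show ?case using \<open>e > 0\<close> by simp
  qed
qed

end
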